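(* Let $s\ge 3$ and $q\ge 1$ be integers, let $G$ be an $(s,q)$-first-failing graph, and let $Y\subseteq G$ be a subgraph with $\chi(Y)=h$. Then $Y$ contains a family of pairwise vertex-disjoint cycles of length $s$ of size at least $$\frac1s M_s(h-q-1),$$ with the bound interpreted as $0$ if $h-q-1<1$. Moreover, if $c=\lceil h/q\rceil$, then $Y$ contains a family of pairwise edge-disjoint cycles of length $s$ of size at least $$\frac{c-1}{2s}M_s(c-1),$$ again interpreted as $0$ when $c-1<1$.
   Context: All graphs are finite and simple; subgraphs need not be induced. $\chi$ is the chromatic number. The girth of a forest is $\infty$. A graph $G$ is $(s,q)$-first-failing if (i) $\operatorname{girth}(G)\ge s$, and (ii) every subgraph of $G$ containing no cycle of length exactly $s$ is $q$-colourable. For $d\ge1$, $M_s(d)$ is the Moore bound $$M_s(d)=\begin{cases}1+d\sum_{i=0}^{a-1}(d-1)^i, & s=2a+1,\\ 2\sum_{i=0}^{a-1}(d-1)^i, & s=2a,\end{cases}$$ with the convention $0^0=1$. *)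

theory Defs
  imports Complex_Main "HOL-Library.Extended_Nat"
begin

type_synonym 'a graph = "'a set \<times> 'a set set"

abbreviation verts :: "'a graph \<Rightarrow> 'a set" where
  "verts G \<equiv> fst G"

abbreviation edges :: "'a graph \<Rightarrow> 'a set set" where
  "edges G \<equiv> snd G"

definition simple_graph :: "'a graph \<Rightarrow> bool" where
  "simple_graph G \<longleftrightarrow> finite (verts G) \<and> (\<forall>e\<in>edges G. e \<subseteq> verts G \<and> card e = 2)"

definition subgraph :: "'a graph \<Rightarrow> 'a graph \<Rightarrow> bool" where
  "subgraph H G \<longleftrightarrow> simple_graph H \<and> verts H \<subseteq> verts G \<and> edges H \<subseteq> edges G"

definition colourable :: "nat \<Rightarrow> 'a graph \<Rightarrow> bool" where
  "colourable k G \<longleftrightarrow>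
     (\<exists>f :: 'a \<Rightarrow> nat. f ` verts G \<subseteq> {..<k} \<and> (\<forall>u v. {u, v} \<in> edges G \<longrightarrow> f u \<noteq> f v))"

definition chromatic_number :: "'a graph \<Rightarrow> nat" where
  "chromatic_number G = (LEAST k. colourable k G)"

(* Cycles are graphs, not vertex sequences: a cycle has no base point and no orientation. *)
definition is_cycle :: "nat \<Rightarrow> 'a graph \<Rightarrow> bool" where
  "is_cycle k C \<longleftrightarrow> 3 \<le> k \<and>
     (\<exists>vs. distinct vs \<and> length vs = k \<and> verts C = set vs \<and>
           edges C = {{vs ! i, vs ! (Suc i mod k)} | i. i < k})"

definition cycles_in :: "nat \<Rightarrow> 'a graph \<Rightarrow> 'a graph set" where
  "cycles_in k G = {C. is_cycle k C \<and> subgraph C G}"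

(* The infimum of the empty set in enat is infinity, as required for forests. *)
definition girth :: "'a graph \<Rightarrow> enat" where
  "girth G = Inf {enat k | k. cycles_in k G \<noteq> {}}"

definition first_failing :: "nat \<Rightarrow> nat \<Rightarrow> 'a graph \<Rightarrow> bool" where
  "first_failing s q G \<longleftrightarrow> enat s \<le> girth G \<and>
     (\<forall>H. subgraph H G \<and> cycles_in s H = {} \<longrightarrow> colourable q H)"

(* Meaningful only for d \<ge> 1: at d = 0 the natural-number subtraction d - 1 truncates. *)
definition moore :: "nat \<Rightarrow> nat \<Rightarrow> nat" where
  "moore s d =
     (if odd s then 1 + d * (\<Sum>i<s div 2. (d - 1) ^ i) else 2 * (\<Sum>i<s div 2. (d - 1) ^ i))"

end

theory Submission imports Defs "HOL-Library.Sublist" begin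

text \<open>
  Remove from \<open>Y\<close> the vertices (respectively the edges) of a maximal disjoint family of
  \<open>s\<close>-cycles. The remainder has no \<open>s\<close>-cycle, hence is \<open>q\<close>-colourable, so what was removed has
  chromatic number at least \<open>h - q\<close> (respectively \<open>c\<close>, by a product colouring). It therefore has a
  subgraph of large minimum degree, and the Moore bound makes that subgraph large.
  The Moore bound comes from counting non-backtracking walks: below the girth, such a walk
  never meets itself, so short walks from a common root have different ends.
\<close>

section \<open>Neighbours, cycles and girth in finite simple graphs\<close>

definition neighbours :: "'a graph \<Rightarrow> 'a \<Rightarrow> 'a set" where
  "neighbours H v = {w. {v, w} \<in> edges H}"

lemma edge_endpoints:
  assumes "simple_graph H" "{u, v} \<in> edges H"
  shows "u \<in> verts H" "v \<in> verts H" "u \<noteq> v"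
  using assms by (auto simp: simple_graph_def)

lemma neighbours_subset: "simple_graph H \<Longrightarrow> neighbours H v \<subseteq> verts H"
  by (auto simp: neighbours_def dest: edge_endpoints)

lemma finite_verts: "simple_graph H \<Longrightarrow> finite (verts H)"
  by (simp add: simple_graph_def)

lemma finite_edges: "simple_graph H \<Longrightarrow> finite (edges H)"
  by (rule finite_subset[of _ "Pow (verts H)"]) (auto simp: simple_graph_def)

lemma finite_neighbours: "simple_graph H \<Longrightarrow> finite (neighbours H v)"
  using neighbours_subset finite_verts finite_subset by metis

lemma subgraph_trans: "subgraph K H \<Longrightarrow> subgraph H G \<Longrightarrow> subgraph K G"
  by (auto simp: subgraph_def)

lemma cycles_in_mono: "subgraph H G \<Longrightarrow> cycles_in k H \<subseteq> cycles_in k G"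
  by (auto simp: cycles_in_def intro: subgraph_trans)

text \<open>Power sets bound the possible pairs of vertex and edge sets. Finiteness is what later
  yields a maximal disjoint family of cycles.\<close>

lemma finite_cycles_in:
  assumes "finite (verts G)"
  shows "finite (cycles_in k G)"
proof (rule finite_subset)
  show "cycles_in k G \<subseteq> Pow (verts G) \<times> Pow (Pow (verts G))"
    by (auto simp: cycles_in_def subgraph_def simple_graph_def) blast
  show "finite (Pow (verts G) \<times> Pow (Pow (verts G)))"
    using assms by simp
qed

lemma card_verts_cycle: "is_cycle k C \<Longrightarrow> card (verts C) = k"
  by (auto simp: is_cycle_def distinct_card)

lemma edges_cycle_image:
  assumes "is_cycle k C"
  obtains f where "edges C = f ` {..<k}"
proof -
  obtain vs where "edges C = {{vs ! i, vs ! (Suc i mod k)} | i. i < k}"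
    using assms unfolding is_cycle_def by blast
  then have "edges C = (\<lambda>i. {vs ! i, vs ! (Suc i mod k)}) ` {..<k}" by auto
  then show ?thesis by (rule that)
qed

lemma card_edges_cycle_le: "is_cycle k C \<Longrightarrow> card (edges C) \<le> k"
  using card_image_le[of "{..<k}"] by (auto elim!: edges_cycle_image)

lemma edges_cycle_nonempty:
  assumes "is_cycle k C"
  shows "edges C \<noteq> {}"
proof -
  have "0 < k" using assms by (simp add: is_cycle_def)
  then show ?thesis using edges_cycle_image[OF assms] by (metis image_is_empty lessThan_iff empty_iff)
qed

lemma no_cycle_below_girth:
  assumes "enat s \<le> girth G" "k < s"
  shows "cycles_in k G = {}"
proof (rule ccontr)
  assume "cycles_in k G \<noteq> {}"
  then have "girth G \<le> enat k"
    unfolding girth_def by (intro Inf_lower) blast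
  with assms show False
    by (meson enat_ord_simps(1) leD order_trans)
qed

section \<open>Non-backtracking walks and the cycles they force\<close>

text \<open>Walks are nonempty vertex lists, so \<open>hd\<close> and \<open>last\<close> are their
  ends; a list of n vertices has n - 1 edges. The clause \<open>x \<noteq> z\<close> forbids only an
  immediate reversal.\<close>

fun nb_walk :: "'a set set \<Rightarrow> 'a list \<Rightarrow> bool" where
  "nb_walk E [] = False"
| "nb_walk E [x] = True"
| "nb_walk E [x, y] = ({x, y} \<in> E)"
| "nb_walk E (x # y # z # zs) = ({x, y} \<in> E \<and> x \<noteq> z \<and> nb_walk E (y # z # zs))"

text \<open>When a walk is cut at \<open>u\<close>, the only condition seen by neither piece is the
  turn at \<open>u\<close> itself.\<close>

lemma nb_walk_append:
  "nb_walk E (xs @ u # ys) \<longleftrightarrow>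
     nb_walk E (xs @ [u]) \<and> nb_walk E (u # ys) \<and> (xs = [] \<or> ys = [] \<or> last xs \<noteq> hd ys)"
proof (induction E xs rule: nb_walk.induct)
  case (2 E x)
  then show ?case by (cases ys) auto
next
  case (3 E x y)
  then show ?case by (cases ys) auto
qed auto

lemma nb_walk_rev: "nb_walk E (rev xs) = nb_walk E xs"
proof (induction E xs rule: nb_walk.induct)
  case (3 E x y)
  then show ?case by (simp add: insert_commute)
next
  case (4 E x y z zs)
  have "nb_walk E (rev (x # y # z # zs)) \<longleftrightarrow> nb_walk E ((rev zs @ [z]) @ y # [x])"
    by simp
  also have "\<dots> \<longleftrightarrow> nb_walk E (rev (y # z # zs)) \<and> {y, x} \<in> E \<and> z \<noteq> x"
    by (subst nb_walk_append) auto
  finally show ?case using 4 by (auto simp: insert_commute)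
qed auto

lemma nb_walk_edge:
  "nb_walk E xs \<Longrightarrow> Suc i < length xs \<Longrightarrow> {xs ! i, xs ! Suc i} \<in> E"
proof (induction E xs arbitrary: i rule: nb_walk.induct)
  case (4 E x y z zs)
  then show ?case by (cases i) auto
qed auto

lemma nb_walk_no_return:
  "nb_walk E xs \<Longrightarrow> Suc (Suc i) < length xs \<Longrightarrow> xs ! i \<noteq> xs ! Suc (Suc i)"
proof (induction E xs arbitrary: i rule: nb_walk.induct)
  case (4 E x y z zs)
  then show ?case by (cases i) auto
qed auto

text \<open>Each vertex is an end of an edge of the walk. The length bound is there because a
  one-vertex walk has no edge to place its vertex in \<open>H\<close>.\<close>

lemma nb_walk_subset_verts:
  assumes H: "simple_graph H" and w: "nb_walk (edges H) xs" and "2 \<le> length xs"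
  shows "set xs \<subseteq> verts H"
proof
  fix x assume "x \<in> set xs"
  then obtain i where i: "i < length xs" "x = xs ! i" by (auto simp: in_set_conv_nth)
  show "x \<in> verts H"
  proof (cases "Suc i < length xs")
    case True
    then show ?thesis using nb_walk_edge[OF w True] edge_endpoints[OF H] i by auto
  next
    case False
    with i assms(3) obtain j where "i = Suc j" by (cases i) auto
    then show ?thesis using nb_walk_edge[OF w, of j] edge_endpoints[OF H] i by auto
  qed
qed

text \<open>A closest pair of repeated vertices on the walk cuts out a cycle.\<close>

lemma nb_walk_not_distinct_cycle:
  assumes H: "simple_graph H" and w: "nb_walk (edges H) xs" and nd: "\<not> distinct xs"
  shows "\<exists>k < length xs. cycles_in k H \<noteq> {}"
proof -
  \<comment> \<open>\<open>P k\<close> says that some vertex recurs at distance \<open>k\<close>.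
    For the least such \<open>k\<close>, the \<open>k\<close> vertices before the recurrence are
    distinct.\<close>
  define P where "P k \<longleftrightarrow> (\<exists>i. 0 < k \<and> i + k < length xs \<and> xs ! i = xs ! (i + k))" for k
  have "\<exists>k. P k"
  proof -
    obtain i j where "i < j" "j < length xs" "xs ! i = xs ! j"
      using nd unfolding distinct_conv_nth by (metis nat_neq_iff)
    then show ?thesis unfolding P_def by (intro exI[of _ "j - i"] exI[of _ i]) auto
  qed
  then obtain k where "P k" and least: "\<And>m. m < k \<Longrightarrow> \<not> P m"
    by (metis LeastI not_less_Least)
  then obtain i where i: "0 < k" "i + k < length xs" "xs ! i = xs ! (i + k)"
    unfolding P_def by auto
  have edge: "{xs ! j, xs ! Suc j} \<in> edges H" if "j < i + k" for j
    using nb_walk_edge[OF w] that i by simp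
  \<comment> \<open>Distance 1 would be a loop and distance 2 an immediate reversal.\<close>
  have "k \<noteq> 1"
    using edge[of i] i edge_endpoints(3)[OF H, of "xs ! i" "xs ! Suc i"] by auto
  moreover have "k \<noteq> 2"
    using nb_walk_no_return[OF w, of i] i by auto
  ultimately have k: "3 \<le> k" using i by linarith
  define vs where "vs = take k (drop i xs)"
  have len: "length vs = k" using i by (simp add: vs_def)
  have nth: "vs ! j = xs ! (i + j)" if "j < k" for j
    using that i by (simp add: vs_def)
  \<comment> \<open>The wrap-around index 0 also gives the next vertex of the walk, because
    \<open>xs ! (i + k) = xs ! i\<close>; so the closing edge is an edge of the walk.\<close>
  have nth_mod: "vs ! (Suc j mod k) = xs ! Suc (i + j)" if "j < k" for j
  proof (cases "Suc j = k")
    case True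
    then show ?thesis using i nth[of 0] by auto
  next
    case False
    then show ?thesis using nth[of "Suc j"] that by simp
  qed
  have dist: "distinct vs"
    unfolding distinct_conv_nth
  proof (intro allI impI)
    have *: "vs ! a \<noteq> vs ! b" if "a < b" "b < k" for a b
    proof
      assume "vs ! a = vs ! b"
      then have "xs ! (i + a) = xs ! (i + a + (b - a))" using that nth by simp
      then have "P (b - a)" unfolding P_def using that i by (intro exI[of _ "i + a"]) simp
      then show False using least[of "b - a"] that by simp
    qed
    fix a b assume "a < length vs" "b < length vs" "a \<noteq> b"
    then show "vs ! a \<noteq> vs ! b"
      using *[of a b] *[of b a] len by (metis nat_neq_iff)
  qed
  define C where "C = (set vs, {{vs ! j, vs ! (Suc j mod k)} | j. j < k})"
  have "is_cycle k C"
    unfolding is_cycle_def C_def using k len dist by auto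
  moreover have sub: "e \<in> edges H \<and> e \<subseteq> set vs" if e: "e \<in> edges C" for e
  proof -
    obtain j where j: "j < k" "e = {vs ! j, vs ! (Suc j mod k)}"
      using e by (auto simp: C_def)
    then have "e \<in> edges H" using edge[of "i + j"] nth nth_mod by simp
    moreover have "e \<subseteq> set vs" using j len by auto
    ultimately show ?thesis by simp
  qed
  moreover have "set vs \<subseteq> verts H"
    using nb_walk_subset_verts[OF H w] i k set_take_subset set_drop_subset
    unfolding vs_def by fastforce
  ultimately have "C \<in> cycles_in k H"
    using H unfolding cycles_in_def subgraph_def simple_graph_def
    by (auto simp: C_def)
  then show ?thesis using i by (intro exI[of _ k]) auto
qed

text \<open>Follow \<open>p\<close> backwards from the common end to the vertex where the two walks
  part, then follow \<open>q\<close> forwards. This walk does not reverse at the turn and returns to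
  its start, so it contains a cycle, whose length is at least \<open>s\<close>. In terms of edges,
  \<open>p\<close> and \<open>q\<close> together have at least \<open>s\<close>.\<close>

lemma nb_walks_same_ends:
  assumes H: "simple_graph H" and girth: "\<And>k. k < s \<Longrightarrow> cycles_in k H = {}"
    and p: "nb_walk (edges H) p" and q: "nb_walk (edges H) q"
    and "hd p = hd q" "last p = last q" "p \<noteq> q"
  shows "s + 2 \<le> length p + length q"
proof (rule ccontr)
  assume short: "\<not> ?thesis"
  obtain ps xs ys where d: "p = ps @ xs" "q = ps @ ys" "xs = [] \<or> ys = [] \<or> hd xs \<noteq> hd ys"
    using longest_common_prefix[of p q] by auto
  have ne: "p \<noteq> []" "q \<noteq> []" using p q by auto
  \<comment> \<open>The common first vertex lies in the common prefix; \<open>u\<close>, the last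
    vertex of the prefix, is where the walks part.\<close>
  have "ps \<noteq> []"
    using d ne assms(5) by (metis append_Nil)
  then obtain rs u where ps: "ps = rs @ [u]" by (metis rev_exhaust)
  have "nb_walk (edges H) (u # xs)" "nb_walk (edges H) (u # ys)"
    using p q d ps nb_walk_append[of "edges H" rs u xs] nb_walk_append[of "edges H" rs u ys]
    by simp_all
  then have w: "nb_walk (edges H) (rev xs @ u # ys)"
    using d(3) nb_walk_rev[of "edges H" "u # xs"] by (subst nb_walk_append) (auto simp: last_rev)
  have "hd (rev xs @ u # ys) = last (rev xs @ u # ys)"
    using assms(6) d ps by (auto simp: hd_append hd_rev split: if_splits)
  moreover have "2 \<le> length (rev xs @ u # ys)"
    using d assms(7) by (cases xs; cases ys) auto
  ultimately have "\<not> distinct (rev xs @ u # ys)"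
    by (cases "rev xs @ u # ys") (auto split: if_splits)
  then obtain k where "k < length (rev xs @ u # ys)" "cycles_in k H \<noteq> {}"
    using nb_walk_not_distinct_cycle[OF H w] by blast
  \<comment> \<open>As \<open>ps\<close> is nonempty, the closed walk has at most
    \<open>length p + length q - 1 \<le> s\<close> entries, and \<open>k\<close> is smaller
    still.\<close>
  then show False using girth[of k] short d ps by auto
qed

section \<open>Counting walks and the Moore bound\<close>

text \<open>The pair \<open>a\<close> is an oriented first edge and \<open>i\<close> counts the
  edges after it. Both can be read off a walk, so different pairs \<open>(a, i)\<close> give
  disjoint sets.\<close>

definition nb_walks_from :: "'a graph \<Rightarrow> 'a \<times> 'a \<Rightarrow> nat \<Rightarrow> 'a list set" where
  "nb_walks_from H a i =
     {xs. nb_walk (edges H) xs \<and> length xs = i + 2 \<and> take 2 xs = [fst a, snd a]}"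

lemma finite_nb_walks_from:
  assumes "simple_graph H"
  shows "finite (nb_walks_from H a i)"
proof (rule finite_subset)
  show "nb_walks_from H a i \<subseteq> {xs. set xs \<subseteq> verts H \<and> length xs = i + 2}"
    using nb_walk_subset_verts[OF assms] by (fastforce simp: nb_walks_from_def)
  show "finite {xs. set xs \<subseteq> verts H \<and> length xs = i + 2}"
    using finite_lists_length_eq[OF finite_verts[OF assms]] .
qed

text \<open>Walks are extended at the front: \<open>u\<close> may precede any walk with first edge
  from \<open>v\<close> to \<open>w\<close>, provided \<open>w \<noteq> u\<close>. This leaves at
  least \<open>d - 1\<close> choices of \<open>w\<close>, and the resulting walks differ in their
  second step.\<close>

lemma card_nb_walks_from:
  assumes H: "simple_graph H" and deg: "\<And>v. v \<in> verts H \<Longrightarrow> d \<le> card (neighbours H v)"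
    and "{u, v} \<in> edges H"
  shows "(d - 1) ^ i \<le> card (nb_walks_from H (u, v) i)"
  using assms(3)
proof (induction i arbitrary: u v)
  case 0
  then have "[u, v] \<in> nb_walks_from H (u, v) 0" by (simp add: nb_walks_from_def)
  then show ?case
    using finite_nb_walks_from[OF H, of "(u, v)" 0]
    by (metis card_gt_0_iff empty_iff power_0 One_nat_def Suc_leI)
next
  case (Suc i)
  let ?N = "neighbours H v - {u}"
  have fin: "finite ?N" using finite_neighbours[OF H] by simp
  have "v \<in> verts H" using edge_endpoints[OF H Suc.prems] by simp
  then have "d - 1 \<le> card ?N"
    using deg[of v] card_Diff1_le[of "neighbours H v" u] finite_neighbours[OF H, of v]
    by (cases "u \<in> neighbours H v") (auto simp: card_Diff_singleton)
  then have "(d - 1) ^ Suc i \<le> (\<Sum>w\<in>?N. (d - 1) ^ i)"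
    by (simp add: mult_right_mono)
  also have "\<dots> \<le> (\<Sum>w\<in>?N. card (nb_walks_from H (v, w) i))"
    by (intro sum_mono Suc.IH) (auto simp: neighbours_def)
  also have "\<dots> = card (\<Union>w\<in>?N. nb_walks_from H (v, w) i)"
    by (subst card_UN_disjoint)
      (use fin finite_nb_walks_from[OF H] in auto, auto simp: nb_walks_from_def)
  also have "\<dots> = card ((#) u ` (\<Union>w\<in>?N. nb_walks_from H (v, w) i))"
    by (simp add: card_image)
  also have "\<dots> \<le> card (nb_walks_from H (u, v) (Suc i))"
  proof (intro card_mono finite_nb_walks_from[OF H] image_subsetI)
    fix xs assume "xs \<in> (\<Union>w\<in>?N. nb_walks_from H (v, w) i)"
    then obtain w where w: "xs \<in> nb_walks_from H (v, w) i" "w \<noteq> u" by blast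
    then obtain zs where "xs = v # w # zs"
      by (cases xs; cases "tl xs") (auto simp: nb_walks_from_def)
    with w Suc.prems show "u # xs \<in> nb_walks_from H (u, v) (Suc i)"
      by (auto simp: nb_walks_from_def)
  qed
  finally show ?case .
qed

text \<open>This produces the geometric sum of the Moore bound. \<open>A\<close> will be the arcs
  leaving a root vertex when \<open>s\<close> is odd, and the two orientations of a root edge when
  \<open>s\<close> is even.\<close>

lemma card_nb_walks_from_arcs:
  assumes H: "simple_graph H" and deg: "\<And>v. v \<in> verts H \<Longrightarrow> d \<le> card (neighbours H v)"
    and A: "finite A" "\<And>u v. (u, v) \<in> A \<Longrightarrow> {u, v} \<in> edges H"
  shows "card A * (\<Sum>i<n. (d - 1) ^ i) \<le> card (\<Union>a\<in>A. \<Union>i<n. nb_walks_from H a i)"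
proof -
  have "card A * (\<Sum>i<n. (d - 1) ^ i) = (\<Sum>a\<in>A. \<Sum>i<n. (d - 1) ^ i)" by simp
  also have "\<dots> \<le> (\<Sum>a\<in>A. \<Sum>i<n. card (nb_walks_from H a i))"
    using card_nb_walks_from[OF H deg] A by (intro sum_mono) auto
  also have "\<dots> = (\<Sum>a\<in>A. card (\<Union>i<n. nb_walks_from H a i))"
    by (intro sum.cong refl, subst card_UN_disjoint)
      (auto simp: finite_nb_walks_from[OF H], auto simp: nb_walks_from_def)
  also have "\<dots> = card (\<Union>a\<in>A. \<Union>i<n. nb_walks_from H a i)"
    by (subst card_UN_disjoint)
      (auto simp: A finite_nb_walks_from[OF H], auto simp: nb_walks_from_def)
  finally show ?thesis .
qed

lemma nb_walks_from_cases:
  assumes "xs \<in> nb_walks_from H (u, v) i"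
  obtains zs where "xs = u # v # zs" "length zs = i" "nb_walk (edges H) xs"
    "nb_walk (edges H) (v # zs)"
proof -
  obtain zs where zs: "xs = u # v # zs"
    using assms by (cases xs; cases "tl xs") (auto simp: nb_walks_from_def)
  then show ?thesis
    using assms that by (cases zs) (auto simp: nb_walks_from_def)
qed

text \<open>The map \<open>last\<close> is injective on walks with at most \<open>a\<close> edges
  from the root: two of them with the same end would close up a cycle shorter than \<open>s\<close>.
  Hence there are at least as many vertices as such walks.\<close>

lemma moore_bound:
  assumes H: "simple_graph H" and ne: "verts H \<noteq> {}"
    and deg: "\<And>v. v \<in> verts H \<Longrightarrow> d \<le> card (neighbours H v)"
    and girth: "\<And>k. k < s \<Longrightarrow> cycles_in k H = {}" and d: "1 \<le> d"
  shows "moore s d \<le> card (verts H)"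
proof -
  define a where "a = s div 2"
  let ?W = "\<lambda>A. \<Union>r\<in>A. \<Union>i<a. nb_walks_from H r i"
  have ends: "s + 2 \<le> length p + length q"
    if "nb_walk (edges H) p" "nb_walk (edges H) q" "hd p = hd q" "last p = last q" "p \<noteq> q" for p q
    using nb_walks_same_ends[OF H _ that] girth by blast
  obtain v where v: "v \<in> verts H" using ne by blast
  have lastW: "last ` ?W A \<subseteq> verts H" for A
  proof safe
    fix x r i assume "x \<in> nb_walks_from H r i"
    then have "set x \<subseteq> verts H" "x \<noteq> []"
      using nb_walk_subset_verts[OF H, of x] by (auto simp: nb_walks_from_def)
    then show "last x \<in> verts H" by auto
  qed
  have finW: "finite (?W A)" if "finite A" for A
    using that finite_nb_walks_from[OF H] by auto
  show ?thesis
  proof (cases "odd s")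
    case True
    then have s: "s = 2 * a + 1" by (simp add: a_def)
    let ?A = "{v} \<times> neighbours H v"
    have finA: "finite ?A" using finite_neighbours[OF H] by simp
    have walk: "nb_walk (edges H) x \<and> hd x = v \<and> length x \<le> a + 1" if "x \<in> insert [v] (?W ?A)" for x
      using that by (auto elim!: nb_walks_from_cases)
    \<comment> \<open>Two lists of at most \<open>a + 1\<close> vertices have total length at most
      \<open>2 * a + 2\<close>, below \<open>s + 2\<close>. The trivial walk \<open>[v]\<close>
      supplies the summand 1 of the odd bound.\<close>
    have inj: "inj_on last (insert [v] (?W ?A))"
    proof (intro inj_onI, rule ccontr)
      fix x y assume "x \<in> insert [v] (?W ?A)" "y \<in> insert [v] (?W ?A)" "last x = last y" "x \<noteq> y"
      then show False using ends[of x y] walk[of x] walk[of y] s by auto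
    qed
    have "d * (\<Sum>i<a. (d - 1) ^ i) \<le> card ?A * (\<Sum>i<a. (d - 1) ^ i)"
      using deg[OF v] by (simp add: card_cartesian_product mult_right_mono)
    also have "\<dots> \<le> card (?W ?A)"
      by (rule card_nb_walks_from_arcs[OF H deg finA]) (auto simp: neighbours_def)
    finally have "moore s d \<le> Suc (card (?W ?A))" using True by (simp add: moore_def a_def)
    also have "\<dots> = card (insert [v] (?W ?A))"
      using finW[OF finA] by (subst card_insert_disjoint) (auto simp: nb_walks_from_def)
    also have "\<dots> = card (last ` insert [v] (?W ?A))"
      using card_image[OF inj] by simp
    also have "\<dots> \<le> card (verts H)"
      using lastW[of ?A] v by (intro card_mono finite_verts[OF H]) auto
    finally show ?thesis .
  next
    case False
    then have s: "s = 2 * a" by (simp add: a_def)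
    have "neighbours H v \<noteq> {}" using deg[OF v] d by auto
    then obtain u where e: "{v, u} \<in> edges H" by (auto simp: neighbours_def)
    then have uv: "u \<noteq> v" using edge_endpoints[OF H] by blast
    let ?A = "{(u, v), (v, u)}"
    \<comment> \<open>The shared first vertex \<open>b\<close> is dropped: the full lists could
      reach total length \<open>2 * a + 2 = s + 2\<close>, whereas the tails reach at most
      \<open>2 * a\<close>.\<close>
    have same: False
      if ass: "x \<in> nb_walks_from H (b, c) i" "y \<in> nb_walks_from H (b, c) j"
        "i < a" "j < a" "last x = last y" "x \<noteq> y" for x y b c i j
    proof -
      obtain zs where zs: "x = b # c # zs" "length zs = i" "nb_walk (edges H) (c # zs)"
        using ass(1) by (auto elim: nb_walks_from_cases)
      obtain ts where ts: "y = b # c # ts" "length ts = j" "nb_walk (edges H) (c # ts)"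
        using ass(2) by (auto elim: nb_walks_from_cases)
      show False using ends[OF zs(3) ts(3)] zs ts ass s by auto
    qed
    \<comment> \<open>Dropping \<open>c\<close> from \<open>y\<close> makes both walks start at
      \<open>b\<close>, with total length at most \<open>2 * a + 1\<close>.\<close>
    have opposite: False
      if ass: "x \<in> nb_walks_from H (b, c) i" "y \<in> nb_walks_from H (c, b) j"
        "i < a" "j < a" "last x = last y" for x y b c i j
    proof -
      obtain zs where zs: "x = b # c # zs" "length zs = i" "nb_walk (edges H) x"
        using ass(1) by (auto elim: nb_walks_from_cases)
      obtain ts where ts: "y = c # b # ts" "length ts = j" "nb_walk (edges H) (b # ts)"
        "nb_walk (edges H) y"
        using ass(2) by (auto elim: nb_walks_from_cases)
      \<comment> \<open>Otherwise \<open>y\<close> would begin \<open>c\<close>, \<open>b\<close>,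
        \<open>c\<close>, an immediate reversal.\<close>
      have "x \<noteq> b # ts" using zs ts by (cases ts) auto
      then show False using ends[OF zs(3) ts(3)] zs ts ass s by auto
    qed
    have inj: "inj_on last (?W ?A)"
    proof (intro inj_onI, rule ccontr)
      fix x y assume "x \<in> ?W ?A" "y \<in> ?W ?A" "last x = last y" "x \<noteq> y"
      then show False
        by (auto dest: same opposite)
    qed
    have "moore s d = card ?A * (\<Sum>i<a. (d - 1) ^ i)"
      using False uv by (simp add: moore_def a_def)
    also have "\<dots> \<le> card (?W ?A)"
      by (rule card_nb_walks_from_arcs[OF H deg]) (use e in \<open>auto simp: insert_commute\<close>)
    also have "\<dots> = card (last ` ?W ?A)"
      using card_image[OF inj] by simp
    also have "\<dots> \<le> card (verts H)"
      using lastW[of ?A] by (intro card_mono finite_verts[OF H])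
    finally show ?thesis .
  qed
qed

section \<open>Colourings: minimum degree and splitting\<close>

text \<open>The intersection with \<open>verts G\<close> lets \<open>U\<close> be a complement in
  the whole type, as in vertex deletion.\<close>

definition induced :: "'a graph \<Rightarrow> 'a set \<Rightarrow> 'a graph" where
  "induced G U = (verts G \<inter> U, {e \<in> edges G. e \<subseteq> U})"

lemma subgraph_induced: "simple_graph G \<Longrightarrow> subgraph (induced G U) G"
  by (auto simp: induced_def subgraph_def simple_graph_def)

text \<open>Delete vertices of degree below \<open>k\<close> one at a time. A
  \<open>k\<close>-colouring of the rest would extend to the deleted vertex by a colour missing at
  its neighbours, so non-colourability persists. The process stops before the graph is empty, since
  the empty graph is \<open>k\<close>-colourable.\<close>

lemma not_colourable_min_degree:
  assumes "simple_graph H" "\<not> colourable k H"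
  obtains K where "subgraph K H" "verts K \<noteq> {}"
    "\<And>v. v \<in> verts K \<Longrightarrow> k \<le> card (neighbours K v)"
proof -
  have "\<exists>K. subgraph K H \<and> verts K \<noteq> {} \<and> (\<forall>v\<in>verts K. k \<le> card (neighbours K v))"
    using assms
  proof (induction "card (verts H)" arbitrary: H rule: less_induct)
    case less
    note H = less.prems(1)
    show ?case
    proof (cases "\<forall>v\<in>verts H. k \<le> card (neighbours H v)")
      case True
      have "verts H \<noteq> {}"
      proof
        assume e: "verts H = {}"
        then have "colourable k H"
          using edge_endpoints[OF H] unfolding colourable_def by (auto simp: e)
        with less.prems show False by simp
      qed
      then show ?thesis using True H by (intro exI[of _ H]) (simp add: subgraph_def)
    next
      case False
      then obtain v where v: "v \<in> verts H" "card (neighbours H v) < k" by auto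
      let ?H = "induced H (- {v})"
      have sub: "subgraph ?H H" using subgraph_induced[OF H] .
      then have sH: "simple_graph ?H" by (simp add: subgraph_def)
      have "card (verts ?H) < card (verts H)"
        using v finite_verts[OF H] by (intro psubset_card_mono) (auto simp: induced_def)
      moreover have "\<not> colourable k ?H"
      proof
        assume "colourable k ?H"
        then obtain f where f: "f ` verts ?H \<subseteq> {..<k}"
          "\<And>x y. {x, y} \<in> edges ?H \<Longrightarrow> f x \<noteq> f y"
          unfolding colourable_def by auto
        have "card (f ` neighbours H v) < card {..<k}"
          using v card_image_le[OF finite_neighbours[OF H], of f v] by simp
        then have "\<not> {..<k} \<subseteq> f ` neighbours H v"
          using card_mono[OF finite_imageI[OF finite_neighbours[OF H]], of "{..<k}" f v] by auto
        then obtain c where c: "c < k" "c \<notin> f ` neighbours H v" by auto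
        let ?g = "f(v := c)"
        have "?g ` verts H \<subseteq> {..<k}"
          using f(1) c by (auto simp: induced_def)
        moreover have "?g x \<noteq> ?g y" if "{x, y} \<in> edges H" for x y
        proof -
          have "{y, x} \<in> edges H" using that by (simp add: insert_commute)
          moreover have "x \<noteq> y" using edge_endpoints[OF H that] by simp
          ultimately show ?thesis
            using that c f(2)[of x y] by (auto simp: neighbours_def induced_def)
        qed
        ultimately have "colourable k H" unfolding colourable_def by blast
        with less.prems show False by simp
      qed
      ultimately show ?thesis
        using less.hyps[OF _ sH] subgraph_trans[OF _ sub] by blast
    qed
  qed
  then show thesis using that by blast
qed

text \<open>The two sides receive disjoint palettes: colours below \<open>n\<close> outside
  \<open>U\<close>, and colours shifted by \<open>n\<close> inside.\<close>

lemma colourable_split_verts: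
  assumes H: "simple_graph H"
    and "colourable m (induced H U)" "colourable n (induced H (- U))"
  shows "colourable (n + m) H"
proof -
  obtain f where f: "f ` verts (induced H U) \<subseteq> {..<m}"
    "\<And>x y. {x, y} \<in> edges (induced H U) \<Longrightarrow> f x \<noteq> f y"
    using assms unfolding colourable_def by auto
  obtain g where g: "g ` verts (induced H (- U)) \<subseteq> {..<n}"
    "\<And>x y. {x, y} \<in> edges (induced H (- U)) \<Longrightarrow> g x \<noteq> g y"
    using assms unfolding colourable_def by auto
  let ?h = "\<lambda>x. if x \<in> U then n + f x else g x"
  have gn: "g x < n" if "x \<in> verts H" "x \<notin> U" for x
    using g(1) that by (auto simp: induced_def)
  have "?h ` verts H \<subseteq> {..<n + m}"
    using f(1) gn by (fastforce simp: induced_def)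
  moreover have "?h x \<noteq> ?h y" if "{x, y} \<in> edges H" for x y
    using f(2)[of x y] g(2)[of x y] that gn[of x] gn[of y] edge_endpoints[OF H that]
    by (auto simp: induced_def)
  ultimately show ?thesis unfolding colourable_def by blast
qed

text \<open>Product colouring: each edge lies in one of the two parts, so one coordinate differs at
  its ends. The pair \<open>(g x, f x)\<close> is encoded as the number
  \<open>g x + n * f x\<close>.\<close>

lemma colourable_split_edges:
  assumes H: "simple_graph H"
    and "colourable m (verts H, E)" "colourable n (verts H, edges H - E)"
  shows "colourable (n * m) H"
proof -
  obtain f where f: "f ` verts H \<subseteq> {..<m}" "\<And>x y. {x, y} \<in> E \<Longrightarrow> f x \<noteq> f y"
    using assms unfolding colourable_def by auto
  obtain g where g: "g ` verts H \<subseteq> {..<n}"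
    "\<And>x y. {x, y} \<in> edges H - E \<Longrightarrow> g x \<noteq> g y"
    using assms unfolding colourable_def by auto
  let ?h = "\<lambda>x. g x + n * f x"
  have gn: "g x < n" and fm: "f x < m" if "x \<in> verts H" for x
    using f(1) g(1) that by auto
  have "?h ` verts H \<subseteq> {..<n * m}"
  proof safe
    fix x assume x: "x \<in> verts H"
    have "?h x < n * Suc (f x)" using gn[OF x] by simp
    also have "\<dots> \<le> n * m" using fm[OF x] by (intro mult_left_mono) auto
    finally show "?h x < n * m" .
  qed
  moreover have "?h x \<noteq> ?h y" if "{x, y} \<in> edges H" for x y
  proof
    assume eq: "?h x = ?h y"
    have xy: "g x < n" "g y < n" using gn edge_endpoints[OF H that] by auto
    \<comment> \<open>The remainder modulo \<open>n\<close> recovers \<open>g\<close>, and then the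
      quotient recovers \<open>f\<close>.\<close>
    have "?h x mod n = ?h y mod n" using eq by simp
    then have "g x = g y" using xy by simp
    with eq xy have "f x = f y" by simp
    with \<open>g x = g y\<close> f(2) g(2) that show False by auto
  qed
  ultimately show ?thesis unfolding colourable_def by blast
qed

lemma not_colourable_below_chromatic_number:
  "k < chromatic_number G \<Longrightarrow> \<not> colourable k G"
  unfolding chromatic_number_def by (rule not_less_Least)

section \<open>Double counting, maximal disjoint families and large dense subgraphs\<close>

text \<open>Incidences of vertices and edges are counted twice: at least \<open>d\<close> at each
  vertex, exactly two on each edge.\<close>

lemma min_degree_card_edges:
  assumes H: "simple_graph H" and deg: "\<And>v. v \<in> verts H \<Longrightarrow> d \<le> card (neighbours H v)"
  shows "d * card (verts H) \<le> 2 * card (edges H)"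
proof -
  have le: "d \<le> card {e \<in> edges H. v \<in> e}" if "v \<in> verts H" for v
  proof -
    have "card (neighbours H v) = card ((\<lambda>w. {v, w}) ` neighbours H v)"
      by (rule card_image[symmetric]) (auto simp: inj_on_def doubleton_eq_iff)
    also have "\<dots> \<le> card {e \<in> edges H. v \<in> e}"
      using finite_edges[OF H] by (intro card_mono) (auto simp: neighbours_def)
    finally show ?thesis using deg[OF that] by simp
  qed
  have "{v \<in> verts H. v \<in> e} = e" if "e \<in> edges H" for e
    using that H by (auto simp: simple_graph_def)
  then have two: "\<forall>e\<in>edges H. card {v \<in> verts H. v \<in> e} = 2"
    using H by (simp add: simple_graph_def)
  have "d * card (verts H) \<le> (\<Sum>v\<in>verts H. card {e \<in> edges H. v \<in> e})"
    using sum_mono[of "verts H" "\<lambda>_. d"] le by (simp add: mult.commute)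
  also have "\<dots> = 2 * card (edges H)"
    using sum_multicount[OF finite_verts[OF H] finite_edges[OF H], of "(\<in>)" 2] two by simp
  finally show ?thesis .
qed

text \<open>Used with \<open>f\<close> as \<open>verts\<close> and as \<open>edges\<close>. A set
  disjoint from an inclusion-maximal family already belongs to it, so it is disjoint from itself;
  this is why the conclusion is emptiness and not a contradiction.\<close>

lemma maximal_disjoint_family:
  fixes f :: "'b \<Rightarrow> 'c set"
  assumes "finite A"
  obtains F where "F \<subseteq> A" "pairwise (\<lambda>C D. f C \<inter> f D = {}) F"
    "\<And>C. C \<in> A \<Longrightarrow> f C \<inter> \<Union>(f ` F) = {} \<Longrightarrow> f C = {}"
proof -
  let ?P = "{F. F \<subseteq> A \<and> pairwise (\<lambda>C D. f C \<inter> f D = {}) F}"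
  have "finite ?P" using assms by (intro finite_subset[of ?P "Pow A"]) auto
  moreover have "?P \<noteq> {}" by (auto intro!: exI[of _ "{}"] simp: pairwise_def)
  ultimately obtain F where F: "F \<in> ?P" and max: "\<forall>F'\<in>?P. F \<subseteq> F' \<longrightarrow> F = F'"
    by (rule finite_has_maximal[THEN bexE])
  show thesis
  proof (rule that)
    show "F \<subseteq> A" "pairwise (\<lambda>C D. f C \<inter> f D = {}) F" using F by auto
    fix C assume C: "C \<in> A" "f C \<inter> \<Union>(f ` F) = {}"
    then have "f C \<inter> f D = {}" if "D \<in> F" for D using that by blast
    then have ins: "insert C F \<in> ?P" using F C(1) by (simp add: pairwise_insert Int_commute)
    have "F = insert C F" using bspec[OF max ins] by (rule mp) (rule subset_insertI)
    then have "C \<in> F" by blast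
    with C show "f C = {}" by auto
  qed
qed

text \<open>The subgraph of minimum degree \<open>d\<close> inherits the absence of short cycles
  from \<open>G\<close>, so the Moore bound applies to it.\<close>

lemma min_degree_order_of_not_colourable:
  assumes G: "enat s \<le> girth G" and H: "subgraph H G" and "\<not> colourable d H" and "1 \<le> d"
  obtains K where "subgraph K H" "moore s d \<le> card (verts K)"
    "\<And>v. v \<in> verts K \<Longrightarrow> d \<le> card (neighbours K v)"
proof -
  obtain K where K: "subgraph K H" "verts K \<noteq> {}"
    "\<And>v. v \<in> verts K \<Longrightarrow> d \<le> card (neighbours K v)"
    using not_colourable_min_degree[OF _ assms(3)] H by (auto simp: subgraph_def)
  have "cycles_in k K = {}" if "k < s" for k
    using no_cycle_below_girth[OF G that] cycles_in_mono[OF subgraph_trans[OF K(1) H]] by blast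
  then have "moore s d \<le> card (verts K)"
    using K assms(4) by (intro moore_bound) (auto simp: subgraph_def)
  with K that show thesis by blast
qed

section \<open>Packing disjoint \<open>s\<close>-cycles\<close>

text \<open>The vertices covered by a maximal family number at most \<open>s * card F\<close>, yet
  they induce a graph that is not \<open>d\<close>-colourable and so has at least
  \<open>moore s d\<close> vertices.\<close>

lemma vertex_disjoint_cycles:
  assumes ff: "first_failing s q G" and Y: "subgraph Y G" and s: "3 \<le> s"
    and d: "1 \<le> d" "q + d < chromatic_number Y"
  obtains F where "finite F" "F \<subseteq> cycles_in s Y"
    "pairwise (\<lambda>C D. verts C \<inter> verts D = {}) F" "moore s d \<le> s * card F"
proof -
  have sY: "simple_graph Y" using Y by (simp add: subgraph_def)
  have fin: "finite (cycles_in s Y)" using finite_cycles_in[OF finite_verts[OF sY]] .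
  obtain F where F: "F \<subseteq> cycles_in s Y" "pairwise (\<lambda>C D. verts C \<inter> verts D = {}) F"
    and max: "\<And>C. C \<in> cycles_in s Y \<Longrightarrow> verts C \<inter> \<Union>(verts ` F) = {} \<Longrightarrow> verts C = {}"
    using maximal_disjoint_family[OF fin, of verts] by blast
  have finF: "finite F" using F fin finite_subset by blast
  let ?U = "\<Union>(verts ` F)"
  note sub = subgraph_induced[OF sY]
  have "cycles_in s (induced Y (- ?U)) = {}"
  proof (rule ccontr)
    assume "cycles_in s (induced Y (- ?U)) \<noteq> {}"
    then obtain C where C: "C \<in> cycles_in s (induced Y (- ?U))" by blast
    then have "verts C \<inter> ?U = {}"
      by (auto simp: cycles_in_def subgraph_def induced_def)
    then have "verts C = {}" using max[of C] C cycles_in_mono[OF sub] by blast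
    moreover have "card (verts C) = s" using C by (simp add: cycles_in_def card_verts_cycle)
    ultimately show False using s by simp
  qed
  then have "colourable q (induced Y (- ?U))"
    using ff subgraph_trans[OF sub Y] unfolding first_failing_def by blast
  then have "\<not> colourable d (induced Y ?U)"
    using colourable_split_verts[OF sY] not_colourable_below_chromatic_number[OF d(2)] by blast
  then obtain K where K: "subgraph K (induced Y ?U)" "moore s d \<le> card (verts K)"
    using min_degree_order_of_not_colourable[OF _ subgraph_trans[OF sub Y] _ d(1)] ff
    unfolding first_failing_def by metis
  have cyc: "card (verts C) = s" if "C \<in> F" for C
    using F that by (auto simp: cycles_in_def card_verts_cycle)
  \<comment> \<open>An infinite set would have \<open>card\<close> 0, but here it is
    \<open>s \<ge> 3\<close>.\<close>
  have "finite (verts C)" if "C \<in> F" for C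
    using cyc[OF that] s card.infinite by fastforce
  then have "finite ?U" using finF by blast
  moreover have "verts K \<subseteq> ?U" using K by (auto simp: subgraph_def induced_def)
  ultimately have "card (verts K) \<le> card ?U" by (rule card_mono)
  also have "\<dots> \<le> (\<Sum>C\<in>F. card (verts C))" by (rule card_UN_le[OF finF])
  also have "\<dots> = s * card F" using cyc by simp
  finally show thesis using that finF F K by simp
qed

text \<open>Deleting edges calls for the product colouring, hence \<open>q * d\<close> in place of
  \<open>q + d\<close>. Covered edges are now counted: a subgraph of minimum degree \<open>d\<close>
  on at least \<open>moore s d\<close> vertices has at least half of \<open>d * moore s d\<close>
  edges, all on the chosen cycles.\<close>

lemma edge_disjoint_cycles:
  assumes ff: "first_failing s q G" and Y: "subgraph Y G"
    and d: "1 \<le> d" "q * d < chromatic_number Y"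
  obtains F where "finite F" "F \<subseteq> cycles_in s Y"
    "pairwise (\<lambda>C D. edges C \<inter> edges D = {}) F" "d * moore s d \<le> 2 * (s * card F)"
proof -
  have sY: "simple_graph Y" using Y by (simp add: subgraph_def)
  have fin: "finite (cycles_in s Y)" using finite_cycles_in[OF finite_verts[OF sY]] .
  obtain F where F: "F \<subseteq> cycles_in s Y" "pairwise (\<lambda>C D. edges C \<inter> edges D = {}) F"
    and max: "\<And>C. C \<in> cycles_in s Y \<Longrightarrow> edges C \<inter> \<Union>(edges ` F) = {} \<Longrightarrow> edges C = {}"
    using maximal_disjoint_family[OF fin, of edges] by blast
  have finF: "finite F" using F fin finite_subset by blast
  let ?E = "\<Union>(edges ` F)"
  have EY: "?E \<subseteq> edges Y" using F by (auto simp: cycles_in_def subgraph_def)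
  have sub: "subgraph (verts Y, E) Y" if "E \<subseteq> edges Y" for E
    using sY that by (auto simp: subgraph_def simple_graph_def)
  note sub1 = sub[of "edges Y - ?E", OF Diff_subset]
  \<comment> \<open>All vertices are kept, so that both colourings live on \<open>verts Y\<close>. A
    surviving \<open>s\<close>-cycle would have no edges by maximality, which is impossible.\<close>
  have "cycles_in s (verts Y, edges Y - ?E) = {}"
  proof (rule ccontr)
    assume "cycles_in s (verts Y, edges Y - ?E) \<noteq> {}"
    then obtain C where C: "C \<in> cycles_in s (verts Y, edges Y - ?E)" by blast
    then have "edges C \<subseteq> edges Y - ?E"
      by (simp add: cycles_in_def subgraph_def)
    then have "edges C = {}" using max[of C] C cycles_in_mono[OF sub1] by blast
    then show False using C edges_cycle_nonempty[of s C] by (auto simp: cycles_in_def)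
  qed
  then have "colourable q (verts Y, edges Y - ?E)"
    using ff subgraph_trans[OF sub1 Y] unfolding first_failing_def by blast
  then have "\<not> colourable d (verts Y, ?E)"
    using colourable_split_edges[OF sY] not_colourable_below_chromatic_number[OF d(2)] by blast
  then obtain K where K: "subgraph K (verts Y, ?E)" "moore s d \<le> card (verts K)"
    "\<And>v. v \<in> verts K \<Longrightarrow> d \<le> card (neighbours K v)"
    using min_degree_order_of_not_colourable[OF _ subgraph_trans[OF sub[OF EY] Y] _ d(1)] ff
    unfolding first_failing_def by metis
  have "d * moore s d \<le> d * card (verts K)" using K by simp
  also have "\<dots> \<le> 2 * card (edges K)"
    using K by (intro min_degree_card_edges) (auto simp: subgraph_def)
  also have "card (edges K) \<le> card ?E"
    using K finite_subset[OF EY finite_edges[OF sY]] by (intro card_mono) (auto simp: subgraph_def)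
  also have "card ?E \<le> (\<Sum>C\<in>F. card (edges C))" by (rule card_UN_le[OF finF])
  also have "\<dots> \<le> (\<Sum>C\<in>F. s)"
    using F by (intro sum_mono card_edges_cycle_le) (auto simp: cycles_in_def)
  finally show thesis using that finF F by (simp add: mult.commute)
qed

section \<open>The two bounds over the reals\<close>

theorem theorem1p7:
  fixes G Y :: "'a graph" and s q h c :: nat
  assumes "3 \<le> s" and "1 \<le> q"
    and "simple_graph G" and "first_failing s q G"
    and "subgraph Y G" and "chromatic_number Y = h"
    and "int c = \<lceil>real h / real q\<rceil>"
  shows "(\<exists>F. finite F \<and> F \<subseteq> cycles_in s Y \<and>
              pairwise (\<lambda>C D. verts C \<inter> verts D = {}) F \<and>
              real (card F) \<ge>
                (if int h - int q - 1 < 1 then 0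
                 else 1 / real s * real (moore s (h - q - 1)))) \<and>
         (\<exists>F. finite F \<and> F \<subseteq> cycles_in s Y \<and>
              pairwise (\<lambda>C D. edges C \<inter> edges D = {}) F \<and>
              real (card F) \<ge>
                (if int c - 1 < 1 then 0
                 else real (c - 1) / (2 * real s) * real (moore s (c - 1))))"
proof (intro conjI)
  show "\<exists>F. finite F \<and> F \<subseteq> cycles_in s Y \<and>
              pairwise (\<lambda>C D. verts C \<inter> verts D = {}) F \<and>
              real (card F) \<ge>
                (if int h - int q - 1 < 1 then 0
                 else 1 / real s * real (moore s (h - q - 1)))"
  proof (cases "int h - int q - 1 < 1")
    case True
    then show ?thesis by (intro exI[of _ "{}"]) simp
  next
    case False
    \<comment> \<open>The guard is over the integers, so here \<open>h \<ge> q + 2\<close> and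
      natural subtraction does not truncate; \<open>q + (h - q - 1)\<close> is
      \<open>h - 1\<close>.\<close>
    then have "1 \<le> h - q - 1" "q + (h - q - 1) < chromatic_number Y"
      using assms(6) by auto
    from vertex_disjoint_cycles[OF assms(4,5,1) this] obtain F where
      F: "finite F" "F \<subseteq> cycles_in s Y" "pairwise (\<lambda>C D. verts C \<inter> verts D = {}) F"
      and le: "moore s (h - q - 1) \<le> s * card F" by blast
    have "real (moore s (h - q - 1)) \<le> real s * real (card F)"
      using le by (metis of_nat_le_iff of_nat_mult)
    then have "1 / real s * real (moore s (h - q - 1)) \<le> real (card F)"
      using assms(1) by (simp add: divide_le_eq mult.commute)
    then show ?thesis using F False by auto
  qed
  show "\<exists>F. finite F \<and> F \<subseteq> cycles_in s Y \<and>
              pairwise (\<lambda>C D. edges C \<inter> edges D = {}) F \<and>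
              real (card F) \<ge>
                (if int c - 1 < 1 then 0
                 else real (c - 1) / (2 * real s) * real (moore s (c - 1)))"
  proof (cases "int c - 1 < 1")
    case True
    then show ?thesis by (intro exI[of _ "{}"]) simp
  next
    case False
    \<comment> \<open>A ceiling exceeds its argument by less than 1. Multiplied by \<open>q\<close>,
      this gives the strict inequality that the product colouring requires with
      \<open>d = c - 1\<close>.\<close>
    have "real (c - 1) < real h / real q"
      using assms(7) False by linarith
    then have "real (q * (c - 1)) < real h"
      using assms(2) by (simp add: less_divide_eq mult.commute)
    then have "1 \<le> c - 1" "q * (c - 1) < chromatic_number Y"
      using assms(6) False by (auto simp only: of_nat_less_iff)
    from edge_disjoint_cycles[OF assms(4,5) this] obtain F where
      F: "finite F" "F \<subseteq> cycles_in s Y" "pairwise (\<lambda>C D. edges C \<inter> edges D = {}) F"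
      and le: "(c - 1) * moore s (c - 1) \<le> 2 * (s * card F)" by blast
    have "real (c - 1) * real (moore s (c - 1)) \<le> 2 * real s * real (card F)"
      using of_nat_mono[OF le, where 'a = real] by (simp only: of_nat_mult of_nat_numeral mult.assoc)
    then have "real (c - 1) / (2 * real s) * real (moore s (c - 1)) \<le> real (card F)"
      using assms(1) by (simp add: divide_le_eq mult.commute)
    then show ?thesis using F False by auto
  qed
qed

end
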